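(* (i) (Normalized case) Let $G=1+\sum_{n\ge 1} g_n(x,\boldsymbol t)\lambda^{-n}$ be a solution of the normalized hierarchy. Then the differential form $$\omega_1=g_1\,dx+g_2\,dt_1+\cdots+g_{n+1}\,dt_n+\cdots$$ in the independent variables $x,t_1,t_2,\ldots$ is closed. (ii) (Schwarzian case) Let $G=\sum_{n\ge 0} g_n(x,\boldsymbol t)\lambda^{-n}$ be a solution of the Schwarzian hierarchy. Then the differential form $$\omega_2=\frac{1}{g_0}\left(dx-g_1\,dt_1-g_2\,dt_2-\cdots-g_n\,dt_n-\cdots\right)$$ in the independent variables $x,t_1,t_2,\ldots$ is closed.
   Context: Let $\boldsymbol t=(t_1,t_2,\ldots)$ and $\langle U,V\rangle:=UV_x-U_xV$. Consider $G=G(\lambda,x,\boldsymbol t)=g_0+\frac{g_1}{\lambda}+\frac{g_2}{\lambda^2}+\cdots$, a formal power series in $\lambda^{-1}$ whose coefficients $g_n=g_n(x,\boldsymbol t)$ are smooth functions, subject to the evolution equations $$\frac{\partial G}{\partial t_i}=\langle A_i,G\rangle,\qquad i\ge 1 .$$ Normalized hierarchy: $g_0\equiv 1$ and $A_i=\lambda^i+g_1\lambda^{i-1}+\cdots+g_{i-1}\lambda+g_i$. In terms of coefficients, $\partial_{t_i} g_n=\sum_{k=1}^n\langle g_{n-k},g_{i+k}\rangle$ for $n\ge 0$. Schwarzian hierarchy: $g_0\not\equiv\text{const}$ (with $g_0$ nowhere zero, so that $1/g_0$ makes sense) and $A_i=g_0\lambda^i+g_1\lambda^{i-1}+\cdots+g_{i-1}\lambda$.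 In terms of coefficients, $\partial_{t_i} g_n=\sum_{k=0}^n\langle g_{n-k},g_{i+k}\rangle$ for $n\ge 0$. A formal one-form $\sum_{i\ge 0} f_i\,dt_i$ (with $t_0:=x$) is closed if $\partial f_i/\partial t_j=\partial f_j/\partial t_i$ for all $i,j\ge 0$. *)

theory Defs
  imports
    "HOL-Analysis.Analysis"
    "HOL-Library.Function_Algebras"
    "HOL-Computational_Algebra.Formal_Laurent_Series"
begin

text \<open>
  A point of type \<^typ>\<open>nat \<Rightarrow> real\<close> is a sequence of values of the independent variables:
  coordinate 0 is x and coordinate i > 0 is the time t_i.  Domains are open in the product topology.
\<close>

definition partial_differentiable :: "nat \<Rightarrow> ((nat \<Rightarrow> real) \<Rightarrow> 'a::real_normed_vector) \<Rightarrow> (nat \<Rightarrow> real) \<Rightarrow> bool"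
  where "partial_differentiable i f p \<longleftrightarrow> (\<lambda>s. f (p(i := s))) differentiable (at (p i))"

definition partial_deriv :: "nat \<Rightarrow> ((nat \<Rightarrow> real) \<Rightarrow> 'a::real_normed_vector) \<Rightarrow> (nat \<Rightarrow> real) \<Rightarrow> 'a"
  where "partial_deriv i f p = vector_derivative (\<lambda>s. f (p(i := s))) (at (p i))"

text \<open>
  Smoothness is required in finitely many variables at a time (the remaining ones being frozen):
  all iterated partial derivatives exist, and they are continuous on every finite-dimensional
  coordinate slice of the domain.  No continuity in infinitely many variables jointly is assumed.
\<close>

definition slice_continuous_on ::
    "(nat \<Rightarrow> real) set \<Rightarrow> ((nat \<Rightarrow> real) \<Rightarrow> 'a::real_normed_vector) \<Rightarrow> bool"
  where "slice_continuous_on D f \<longleftrightarrow>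
    (\<forall>I. finite I \<longrightarrow> (\<forall>p\<in>D. continuous_on {q \<in> D. \<forall>j. j \<notin> I \<longrightarrow> q j = p j} f))"

definition smooth_on :: "(nat \<Rightarrow> real) set \<Rightarrow> ((nat \<Rightarrow> real) \<Rightarrow> 'a::real_normed_vector) \<Rightarrow> bool"
  where "smooth_on D f \<longleftrightarrow>
    (\<forall>is. slice_continuous_on D (foldr partial_deriv is f) \<and>
          (\<forall>i. \<forall>p\<in>D. partial_differentiable i (foldr partial_deriv is f) p))"

text \<open>
  Formal Laurent series are taken over the ring of functions with pointwise operations.  Their
  formal variable is the inverse of the spectral parameter, so lambda is \<^term>\<open>fls_X_inv\<close>.
\<close>

type_synonym 'a fun_fps = "((nat \<Rightarrow> real) \<Rightarrow> 'a) fps"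
type_synonym 'a fun_fls = "((nat \<Rightarrow> real) \<Rightarrow> 'a) fls"

definition fls_partial_deriv :: "nat \<Rightarrow> 'a::real_normed_field fun_fls \<Rightarrow> 'a fun_fls"
  where "fls_partial_deriv i F = Abs_fls (\<lambda>n. partial_deriv i (fls_nth F n))"

lemma partial_deriv_zero [simp]: "partial_deriv i 0 = 0"
  by (rule ext) (simp add: partial_deriv_def)

lemma fls_nth_partial_deriv [simp]: "fls_nth (fls_partial_deriv i F) n = partial_deriv i (fls_nth F n)"
  unfolding fls_partial_deriv_def
  by (subst nth_Abs_fls_lower_bound[of "fls_subdegree F"]) auto

definition bracket :: "'a::real_normed_field fun_fls \<Rightarrow> 'a fun_fls \<Rightarrow> 'a fun_fls"
  where "bracket U V = U * fls_partial_deriv 0 V - fls_partial_deriv 0 U * V"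

definition A_normalized :: "'a::real_normed_field fun_fps \<Rightarrow> nat \<Rightarrow> 'a fun_fls"
  where "A_normalized G i =
    fls_X_inv ^ i + (\<Sum>k=1..i. fls_const (fps_nth G k) * fls_X_inv ^ (i - k))"

definition A_schwarzian :: "'a::real_normed_field fun_fps \<Rightarrow> nat \<Rightarrow> 'a fun_fls"
  where "A_schwarzian G i = (\<Sum>k<i. fls_const (fps_nth G k) * fls_X_inv ^ (i - k))"

definition solves_evolution ::
    "(nat \<Rightarrow> real) set \<Rightarrow> (nat \<Rightarrow> 'a::real_normed_field fun_fls) \<Rightarrow> 'a fun_fps \<Rightarrow> bool"
  where "solves_evolution D A G \<longleftrightarrow>
    (\<forall>i\<ge>1. \<forall>n. \<forall>p\<in>D.
      fls_nth (fls_partial_deriv i (fps_to_fls G)) n p = fls_nth (bracket (A i) (fps_to_fls G)) n p)"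

definition normalized_solution ::
    "(nat \<Rightarrow> real) set \<Rightarrow> 'a::real_normed_field fun_fps \<Rightarrow> bool"
  where "normalized_solution D G \<longleftrightarrow>
    (\<forall>n. smooth_on D (fps_nth G n)) \<and>
    (\<forall>p\<in>D. fps_nth G 0 p = 1) \<and>
    solves_evolution D (A_normalized G) G"

definition schwarzian_solution ::
    "(nat \<Rightarrow> real) set \<Rightarrow> 'a::real_normed_field fun_fps \<Rightarrow> bool"
  where "schwarzian_solution D G \<longleftrightarrow>
    (\<forall>n. smooth_on D (fps_nth G n)) \<and>
    \<not> (\<exists>c. \<forall>p\<in>D. fps_nth G 0 p = c) \<and>
    (\<forall>p\<in>D. fps_nth G 0 p \<noteq> 0) \<and>
    solves_evolution D (A_schwarzian G) G"

text \<open>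
  A formal one-form is given by its sequence of coefficient functions, the coefficient with index i
  belonging to the differential of coordinate i.  Existence of the partial derivatives is part of
  closedness, since \<^const>\<open>partial_deriv\<close> is a total function.
\<close>

type_synonym 'a one_form = "nat \<Rightarrow> (nat \<Rightarrow> real) \<Rightarrow> 'a"

definition closed_form_on :: "(nat \<Rightarrow> real) set \<Rightarrow> 'a::real_normed_vector one_form \<Rightarrow> bool"
  where "closed_form_on D \<omega> \<longleftrightarrow>
    (\<forall>i j. \<forall>p\<in>D. partial_differentiable j (\<omega> i) p \<and> partial_deriv j (\<omega> i) p = partial_deriv i (\<omega> j) p)"

definition omega1 :: "'a::real_normed_field fun_fps \<Rightarrow> 'a one_form"
  where "omega1 G n = fps_nth G (n + 1)"

definition omega2 :: "'a::real_normed_field fun_fps \<Rightarrow> 'a one_form"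
  where "omega2 G n = (\<lambda>p. 1 / fps_nth G 0 p * (if n = 0 then 1 else - fps_nth G n p))"

end

theory Submission
  imports Defs
begin

text \<open>
  Both parts follow from the evolution equations and the antisymmetry of the bracket alone; no
  commutation of the flows is needed.  Write \<open>w a b\<close> for
  \<open>\<langle>g\<^sub>a, g\<^sub>b\<rangle>\<close>.  The sum of \<open>w k (i + j - k)\<close> over all \<open>k \<le> i + j\<close> vanishes, and reflecting the tail
  shows that the sum over \<open>k < j\<close> equals the sum over \<open>k \<le> i\<close>.  In the normalized case this is exactly
  \<open>\<partial>\<^sub>j g\<^sub>i\<^sub>+\<^sub>1 = \<partial>\<^sub>i g\<^sub>j\<^sub>+\<^sub>1\<close>.  In the Schwarzian case it yields \<open>\<partial>\<^sub>j g\<^sub>i - \<partial>\<^sub>i g\<^sub>j = \<langle>g\<^sub>i, g\<^sub>j\<rangle>\<close> and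
  \<open>\<partial>\<^sub>i g\<^sub>0 = \<langle>g\<^sub>0, g\<^sub>i\<rangle>\<close>, and the quotient rule gives closedness because
  \<open>g\<^sub>i \<langle>g\<^sub>0, g\<^sub>j\<rangle> - g\<^sub>j \<langle>g\<^sub>0, g\<^sub>i\<rangle> = g\<^sub>0 \<langle>g\<^sub>i, g\<^sub>j\<rangle>\<close>.
\<close>

lemma sum_fun_apply: "(\<Sum>k\<in>S. f k) p = (\<Sum>k\<in>S. f k p)"
  by (induction S rule: infinite_finite_induct) auto

lemma antisym_sum_reflect:
  fixes w :: "nat \<Rightarrow> nat \<Rightarrow> 'a::real_vector"
  assumes antisym: "\<And>a b. w a b = - w b a"
  shows "(\<Sum>k<j. w k (i + j - k)) = (\<Sum>k\<le>i. w k (i + j - k))"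
proof -
  let ?f = "\<lambda>k. w k (i + j - k)"
  have reflect: "sum ?f {m..i + j} = - (\<Sum>k\<le>i + j - m. ?f k)" if "m \<le> i + j" for m
  proof -
    have "sum ?f {m..i + j} = (\<Sum>k\<le>i + j - m. - ?f k)"
      by (rule sum.reindex_bij_witness[of _ "\<lambda>k. i + j - k" "\<lambda>k. i + j - k"])
         (use that in \<open>auto simp: antisym[of "i + j - k" k for k]\<close>)
    then show ?thesis by (simp add: sum_negf)
  qed
  have "sum ?f {..i + j} = - sum ?f {..i + j}"
    using reflect[of 0] by (simp add: atMost_atLeast0)
  then have "sum ?f {..i + j} = 0"
    by (simp add: eq_neg_iff_add_eq_0 flip: scaleR_2)
  moreover have "{..i + j} = {..<j} \<union> {j..i + j}" by auto
  then have "sum ?f {..i + j} = sum ?f {..<j} + sum ?f {j..i + j}"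
    by (simp add: sum.union_disjoint ivl_disj_int)
  ultimately show ?thesis
    using reflect[of j] by simp
qed

text \<open>The Wronskian in x of two coefficients at a fixed point. The point precedes the indices
  so that \<open>coeff_bracket G p\<close> can serve as \<open>w\<close> in
  \<open>antisym_sum_reflect\<close>.\<close>

definition coeff_bracket :: "'a::real_normed_field fun_fps \<Rightarrow> (nat \<Rightarrow> real) \<Rightarrow> nat \<Rightarrow> nat \<Rightarrow> 'a"
  where "coeff_bracket G p a b =
    fps_nth G a p * partial_deriv 0 (fps_nth G b) p - partial_deriv 0 (fps_nth G a) p * fps_nth G b p"

lemma coeff_bracket_antisym: "coeff_bracket G p a b = - coeff_bracket G p b a"
  by (simp add: coeff_bracket_def algebra_simps)

lemma fls_partial_deriv_shift_fps:
  "fls_partial_deriv i (fls_shift m (fps_to_fls P)) =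
    fls_shift m (fps_to_fls (Abs_fps (\<lambda>n. partial_deriv i (fps_nth P n))))"
  by (rule fls_eqI) auto

text \<open>\<open>fls_shift (int m)\<close> multiplies by the m-th power of lambda, so this is the
  Cauchy product read off at degree n + m. The truncation in \<open>A_normalized\<close> and
  \<open>A_schwarzian\<close> enters later, through vanishing coefficients of
  \<open>P\<close>.\<close>

lemma bracket_shift_nth:
  "fls_nth (bracket (fls_shift (int m) (fps_to_fls P)) (fps_to_fls G)) (int n) p =
    (\<Sum>k\<le>n + m. fps_nth P k p * partial_deriv 0 (fps_nth G (n + m - k)) p -
                   partial_deriv 0 (fps_nth P k) p * fps_nth G (n + m - k) p)"
proof -
  have dG: "fls_partial_deriv 0 (fps_to_fls G) =
      fps_to_fls (Abs_fps (\<lambda>n. partial_deriv 0 (fps_nth G n)))"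
    using fls_partial_deriv_shift_fps[of 0 0 G] by simp
  have idx: "nat (int n + int m) = n + m" by simp
  show ?thesis
    unfolding bracket_def fls_partial_deriv_shift_fps dG
    by (simp add: fls_shifted_times_simps fls_times_fps_to_fls[symmetric] fps_mult_nth idx
        sum_fun_apply sum_subtractf atMost_atLeast0)
qed

lemma fls_const_X_inv_power_nth:
  "fls_nth (fls_const c * fls_X_inv ^ m) n = (if n = - int m then c else 0)"
  by (auto simp: fls_X_inv_power_times_conv_shift)

lemma X_inv_power_sum_conv_shift:
  assumes "finite K" "\<And>k. k \<in> K \<Longrightarrow> k \<le> i"
  shows "(\<Sum>k\<in>K. fls_const (c k) * fls_X_inv ^ (i - k)) =
    fls_shift (int i) (fps_to_fls (Abs_fps (\<lambda>k. if k \<in> K then c k else 0)))"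
proof (rule fls_eqI)
  fix n
  \<comment> \<open>The bound k \<le> i keeps \<open>i - k\<close> an honest difference. The guard
    is needed because \<open>nat\<close> sends negative integers to 0, which would otherwise match k
    = 0.\<close>
  have "(\<Sum>k\<in>K. if n = - int (i - k) then c k else 0) =
      (\<Sum>k\<in>K. if k = nat (n + int i) \<and> 0 \<le> n + int i then c k else 0)"
    using assms(2) by (intro sum.cong refl if_cong) force+
  also have "\<dots> = (if 0 \<le> n + int i \<and> nat (n + int i) \<in> K then c (nat (n + int i)) else 0)"
    using assms(1) by (cases "0 \<le> n + int i") (auto simp: sum.delta)
  finally show "fls_nth (\<Sum>k\<in>K. fls_const (c k) * fls_X_inv ^ (i - k)) n =
      fls_nth (fls_shift (int i) (fps_to_fls (Abs_fps (\<lambda>k. if k \<in> K then c k else 0)))) n"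
    by (simp only: fls_nth_sum fls_const_X_inv_power_nth) simp
qed

lemma A_schwarzian_conv_shift:
  "A_schwarzian G i = fls_shift (int i) (fps_to_fls (Abs_fps (\<lambda>k. if k < i then fps_nth G k else 0)))"
  unfolding A_schwarzian_def by (subst X_inv_power_sum_conv_shift) auto

text \<open>The leading coefficient is the constant function 1 and not \<open>fps_nth G 0\<close>,
  which is known to equal 1 only on the domain of a solution.\<close>

lemma A_normalized_conv_shift:
  "A_normalized G i = fls_shift (int i)
    (fps_to_fls (Abs_fps (\<lambda>k. if k = 0 then 1 else if k \<le> i then fps_nth G k else 0)))"
proof -
  let ?c = "\<lambda>k. if k = 0 then 1 else fps_nth G k"
  have "A_normalized G i = (\<Sum>k\<in>insert 0 {1..i}. fls_const (?c k) * fls_X_inv ^ (i - k))"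
    unfolding A_normalized_def by (subst sum.insert) auto
  also have "\<dots> = fls_shift (int i) (fps_to_fls (Abs_fps (\<lambda>k. if k \<in> insert 0 {1..i} then ?c k else 0)))"
    by (rule X_inv_power_sum_conv_shift) auto
  also have "(\<lambda>k. if k \<in> insert 0 {1..i} then ?c k else 0) =
      (\<lambda>k. if k = 0 then 1 else if k \<le> i then fps_nth G k else 0)"
    by auto
  finally show ?thesis .
qed

lemma partial_differentiable_imp_has_vector_derivative:
  assumes "partial_differentiable i f p"
  shows "((\<lambda>s. f (p(i := s))) has_vector_derivative partial_deriv i f p) (at (p i))"
  using assms by (simp add: partial_differentiable_def partial_deriv_def vector_derivative_works)

lemma has_vector_derivative_imp_partial_deriv:
  assumes "((\<lambda>s. f (p(i := s))) has_vector_derivative v) (at (p i))"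
  shows "partial_differentiable i f p" "partial_deriv i f p = v"
  using assms differentiableI_vector[OF assms] vector_derivative_at[OF assms]
  by (auto simp: partial_differentiable_def partial_deriv_def)

lemma smooth_on_imp_partial_differentiable:
  assumes "smooth_on D f" "p \<in> D"
  shows "partial_differentiable i f p"
  using assms unfolding smooth_on_def by (metis foldr.simps(1) id_apply)

lemma partial_deriv_const [simp]: "partial_deriv i (\<lambda>q. c) p = 0"
  by (simp add: partial_deriv_def)

lemma partial_deriv_one [simp]: "partial_deriv i 1 p = 0"
  by (simp add: one_fun_def)

text \<open>A coordinate line through p meets the open set \<open>D\<close> in an open set of
  parameters, so f is constant along the line near p. This makes the x-derivative of the leading
  coefficient vanish in the normalized case.\<close>

lemma partial_deriv_locally_const:
  assumes "open D" "p \<in> D" "\<And>q. q \<in> D \<Longrightarrow> f q = c"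
  shows "partial_deriv i f p = 0"
proof -
  have "continuous_on UNIV (\<lambda>s. (p(i := s)) j)" for j
    by (cases "j = i") auto
  then have "continuous_on UNIV (\<lambda>s. p(i := s))"
    by (rule continuous_on_coordinatewise_then_product)
  then have "open ((\<lambda>s. p(i := s)) -` D)"
    using assms(1) by (simp add: open_vimage)
  then have "((\<lambda>s. f (p(i := s))) has_vector_derivative 0) (at (p i))"
    by (rule has_vector_derivative_transform_within_open[OF has_vector_derivative_const[of c]])
       (use assms in auto)
  then show ?thesis by (rule has_vector_derivative_imp_partial_deriv)
qed

lemma partial_deriv_uminus:
  assumes "partial_differentiable i f p"
  shows "partial_differentiable i (\<lambda>q. - f q) p"
    "partial_deriv i (\<lambda>q. - f q) p = - partial_deriv i f p"
  using has_vector_derivative_minus[OF partial_differentiable_imp_has_vector_derivative[OF assms]]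
  by (auto dest: has_vector_derivative_imp_partial_deriv)

lemma partial_deriv_divide:
  fixes f g :: "(nat \<Rightarrow> real) \<Rightarrow> 'a::real_normed_field"
  assumes "partial_differentiable i f p" "partial_differentiable i g p" "g p \<noteq> 0"
  shows "partial_differentiable i (\<lambda>q. f q / g q) p"
    "partial_deriv i (\<lambda>q. f q / g q) p =
      (partial_deriv i f p * g p - f p * partial_deriv i g p) / (g p * g p)"
proof -
  note derivs = assms(1,2)[THEN partial_differentiable_imp_has_vector_derivative,
      unfolded has_vector_derivative_def]
  have "((\<lambda>s. f (p(i := s)) / g (p(i := s))) has_vector_derivative
      (partial_deriv i f p * g p - f p * partial_deriv i g p) / (g p * g p)) (at (p i))"
    unfolding has_vector_derivative_def
    by (rule has_derivative_eq_rhs[OF has_derivative_divide'[OF derivs]])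
       (use assms(3) in \<open>auto simp: scaleR_diff_right[symmetric] scaleR_conv_of_real field_simps\<close>)
  then show "partial_differentiable i (\<lambda>q. f q / g q) p"
    "partial_deriv i (\<lambda>q. f q / g q) p =
      (partial_deriv i f p * g p - f p * partial_deriv i g p) / (g p * g p)"
    by (rule has_vector_derivative_imp_partial_deriv)+
qed

lemma partial_deriv_coeff_normalized:
  assumes "open D" "normalized_solution D G" "p \<in> D"
  shows "partial_deriv i (fps_nth G (Suc n)) p = (\<Sum>k\<le>i. coeff_bracket G p k (Suc n + i - k))"
proof -
  have g0: "fps_nth G 0 p = 1" "partial_deriv 0 (fps_nth G 0) p = 0"
    using assms partial_deriv_locally_const[of D p "fps_nth G 0" 1 0]
    by (auto simp: normalized_solution_def)
  show ?thesis
  \<comment> \<open>The evolution equations start at i = 1. For the variable x the sum is its k = 0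
    term, which is the x-derivative itself because the leading coefficient is 1.\<close>
  proof (cases "i = 0")
    case True
    then show ?thesis using g0 by (simp add: coeff_bracket_def)
  next
    case False
    have "partial_deriv i (fps_nth G (Suc n)) p =
        fls_nth (fls_partial_deriv i (fps_to_fls G)) (int (Suc n)) p"
      by (simp del: of_nat_Suc)
    also have "\<dots> = fls_nth (bracket (A_normalized G i) (fps_to_fls G)) (int (Suc n)) p"
      using assms False unfolding normalized_solution_def solves_evolution_def
      by (metis One_nat_def Suc_leI gr0I)
    also have "\<dots> = (\<Sum>k\<le>Suc n + i. if k \<le> i then coeff_bracket G p k (Suc n + i - k) else 0)"
      unfolding A_normalized_conv_shift bracket_shift_nth
      \<comment> \<open>At k = 0 the constant 1 and \<open>fps_nth G 0\<close> agree at p together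
        with their x-derivatives.\<close>
      by (intro sum.cong) (auto simp: coeff_bracket_def g0)
    also have "\<dots> = (\<Sum>k\<le>i. coeff_bracket G p k (Suc n + i - k))"
      by (intro sum.mono_neutral_cong_right) auto
    finally show ?thesis .
  qed
qed

text \<open>At i = 0 the sum would be empty, so here x does not fit the pattern of the times and is
  treated separately in the theorem.\<close>

lemma partial_deriv_coeff_schwarzian:
  assumes "schwarzian_solution D G" "p \<in> D" "i > 0"
  shows "partial_deriv i (fps_nth G n) p = (\<Sum>k<i. coeff_bracket G p k (n + i - k))"
proof -
  have "partial_deriv i (fps_nth G n) p = fls_nth (fls_partial_deriv i (fps_to_fls G)) (int n) p"
    by simp
  also have "\<dots> = fls_nth (bracket (A_schwarzian G i) (fps_to_fls G)) (int n) p"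
    using assms unfolding schwarzian_solution_def solves_evolution_def by (metis One_nat_def Suc_leI)
  also have "\<dots> = (\<Sum>k\<le>n + i. if k < i then coeff_bracket G p k (n + i - k) else 0)"
    unfolding A_schwarzian_conv_shift bracket_shift_nth
    by (intro sum.cong) (auto simp: coeff_bracket_def)
  also have "\<dots> = (\<Sum>k<i. coeff_bracket G p k (n + i - k))"
    by (intro sum.mono_neutral_cong_right) auto
  finally show ?thesis .
qed

theorem theorem2:
  fixes D :: "(nat \<Rightarrow> real) set"
    and G :: "((nat \<Rightarrow> real) \<Rightarrow> 'a::real_normed_field) fps"
  assumes "open D"
  shows "(normalized_solution D G \<longrightarrow> closed_form_on D (omega1 G)) \<and>
         (schwarzian_solution D G \<longrightarrow> closed_form_on D (omega2 G))"
proof (intro conjI impI)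
  assume sol: "normalized_solution D G"
  show "closed_form_on D (omega1 G)"
    unfolding closed_form_on_def
  proof (intro allI ballI conjI)
    fix i j p assume p: "p \<in> D"
    show "partial_differentiable j (omega1 G i) p"
      using sol p unfolding normalized_solution_def omega1_def
      by (blast intro: smooth_on_imp_partial_differentiable)
    show "partial_deriv j (omega1 G i) p = partial_deriv i (omega1 G j) p"
      \<comment> \<open>Both derivatives are sums of brackets of total index i + j + 1, over k \<le>
        j and over k < i + 1.\<close>
      using antisym_sum_reflect[of "coeff_bracket G p" j "Suc i", OF coeff_bracket_antisym]
      unfolding omega1_def Suc_eq_plus1[symmetric] partial_deriv_coeff_normalized[OF assms sol p]
        lessThan_Suc_atMost
      by (simp add: add_ac)
  qed
next
  assume sol: "schwarzian_solution D G"
  then have nz: "fps_nth G 0 p \<noteq> 0" if "p \<in> D" for p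
    using that by (auto simp: schwarzian_solution_def)
  let ?h = "\<lambda>n q. if n = 0 then 1 else - fps_nth G n q"
  have omega2: "omega2 G n = (\<lambda>q. ?h n q / fps_nth G 0 q)" for n
    by (auto simp: omega2_def)
  show "closed_form_on D (omega2 G)"
    unfolding closed_form_on_def
  proof (intro allI ballI conjI)
    fix i j p assume p: "p \<in> D"
    let ?w = "coeff_bracket G p"
    have diff: "partial_differentiable m (fps_nth G n) p" for m n
      using sol p unfolding schwarzian_solution_def
      by (blast intro: smooth_on_imp_partial_differentiable)
    have dh: "partial_differentiable m (?h n) p"
      "partial_deriv m (?h n) p = (if n = 0 then 0 else - partial_deriv m (fps_nth G n) p)" for m n
      using partial_deriv_uminus[OF diff[of m n]]
      by (cases "n = 0"; simp add: partial_differentiable_def)+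
    show "partial_differentiable j (omega2 G i) p"
      unfolding omega2 by (rule partial_deriv_divide[OF dh(1) diff nz[OF p]])
    note d = partial_deriv_coeff_schwarzian[OF sol p]
    \<comment> \<open>Reflection leaves only the term k = 0.\<close>
    have d0: "partial_deriv m (fps_nth G 0) p = ?w 0 m" if "m > 0" for m
      using antisym_sum_reflect[of ?w 0 m, OF coeff_bracket_antisym] d[OF that, of 0] by simp
    have dd: "partial_deriv n (fps_nth G m) p - partial_deriv m (fps_nth G n) p = ?w m n"
      if "m > 0" "n > 0" for m n
    proof -
      \<comment> \<open>The reflected sum exceeds the one for the opposite derivative by exactly its
        last term, k = m.\<close>
      have "partial_deriv n (fps_nth G m) p = (\<Sum>k<Suc m. ?w k (m + n - k))"
        using antisym_sum_reflect[of ?w m n, OF coeff_bracket_antisym]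
        unfolding d[OF that(2)] lessThan_Suc_atMost .
      then show ?thesis
        unfolding d[OF that(1), of n] by (simp add: add.commute[of n m])
    qed
    \<comment> \<open>The quotient rule gives both sides the same denominator, so comparing
      numerators suffices. If exactly one index is 0, this is \<open>d0\<close>.\<close>
    have "partial_deriv j (?h i) p * fps_nth G 0 p - ?h i p * partial_deriv j (fps_nth G 0) p =
        partial_deriv i (?h j) p * fps_nth G 0 p - ?h j p * partial_deriv i (fps_nth G 0) p"
    proof (cases "i = 0 \<or> j = 0")
      case True
      then show ?thesis
        using d0[of i] d0[of j] unfolding dh(2)
        by (cases "i = 0"; cases "j = 0") (auto simp: coeff_bracket_def algebra_simps)
    next
      case False
      \<comment> \<open>Expansion of a 3 by 3 determinant whose first two rows are both the values
        of the coefficients 0, i, j and whose third row is their x-derivatives.\<close>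
      have "?w i j * fps_nth G 0 p = fps_nth G i p * ?w 0 j - fps_nth G j p * ?w 0 i"
        by (simp add: coeff_bracket_def algebra_simps)
      moreover have "partial_deriv j (fps_nth G i) p = partial_deriv i (fps_nth G j) p + ?w i j"
        using False dd[of i j] by (simp add: algebra_simps)
      ultimately show ?thesis
        using False d0[of i] d0[of j] unfolding dh(2) by (simp add: algebra_simps)
    qed
    then show "partial_deriv j (omega2 G i) p = partial_deriv i (omega2 G j) p"
      unfolding omega2 partial_deriv_divide(2)[OF dh(1) diff nz[OF p]] by simp
  qed
qed

end
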